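(* Let $t\ge 3$ be an integer, let $M$ be a matroid, and suppose that $\sigma=(e_1, e_2, \ldots, e_n)$ is a cyclic $(t-1, t)$-ordering of $E(M)$, where $n\ge 6t-10$. Then $n$ is even and, for all $i\in [n]$, there is a unique $t$-element circuit and a unique $t$-element cocircuit containing $\{e_i, e_{i+1}, \ldots, e_{i+t-2}\}$. Moreover: (I) If $t$ is odd, then the following hold: (i) For all $i\in [n]$, the subset $\{e_i, e_{i+1}, \ldots, e_{i+t-1}\}$ is either a $t$-element circuit or a $t$-element cocircuit, but not both. (ii) For all $i\in [n]$, the subset $\{e_i, e_{i+1}, \ldots, e_{i+t-1}\}$ is a $t$-element circuit if and only if $\{e_{i+1}, e_{i+2}, \ldots, e_{i+t}\}$ is a $t$-element cocircuit. (iii) For all $i,j\in[n]$ with $j\equiv i \pmod 2$, if $\{e_i, e_{i+1}, \ldots, e_{i+t-1}\}$ is a $t$-element circuit, then $\{e_j, e_{j+1}, \ldots, e_{j+t-1}\}$ is a $t$-element circuit. (II) If $t$ is even, then the following hold: (i) For all $i\in [n]$, exactly one of $\{e_i, e_{i+1}, \ldots, e_{i+t-1}\}$ and $\{e_{i+1}, e_{i+2}, \ldots, e_{i+t}\}$ is a $t$-element circuit. (ii) For all $i\in [n]$, the subset $\{e_i, e_{i+1}, \ldots, e_{i+t-1}\}$ is a $t$-element circuit if and only if it is a $t$-element cocircuit. (iii) For all $i,j\in[n]$ with $j\equiv i \pmod 2$, if $\{e_i, e_{i+1}, \ldots, e_{i+t-1}\}$ is a $t$-element circuit, then $\{e_j,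 e_{j+1}, \ldots, e_{j+t-1}\}$ is a $t$-element circuit.
   Context: Notation: $[n]=\{1,2,\ldots,n\}$. For a cyclic ordering $(e_1,\ldots,e_n)$ of the ground set (each element listed exactly once), all subscripts are interpreted modulo $n$. For an integer $t\ge 2$, a cyclic ordering $\sigma$ of the ground set $E(M)$ of a matroid $M$ is a cyclic $(t-1,t)$-ordering of $M$ if every set of $t-1$ consecutive elements of $\sigma$ is contained in a $t$-element circuit of $M$ and in a $t$-element cocircuit of $M$. *)

theory Defs
  imports Main
begin

record 'a indep_system =
  ground :: "'a set"
  indep :: "'a set \<Rightarrow> bool"

locale matroid =
  fixes M :: "'a indep_system"
  assumes finite_ground: "finite (ground M)"
    and indep_subset_ground: "indep M X \<Longrightarrow> X \<subseteq> ground M"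
    and indep_empty: "indep M {}"
    and indep_subset: "indep M X \<Longrightarrow> Y \<subseteq> X \<Longrightarrow> indep M Y"
    and augmentation:
      "indep M X \<Longrightarrow> indep M Y \<Longrightarrow> card X < card Y \<Longrightarrow> \<exists>y\<in>Y - X. indep M (insert y X)"

definition basis :: "'a indep_system \<Rightarrow> 'a set \<Rightarrow> bool" where
  "basis M B \<longleftrightarrow> indep M B \<and> (\<forall>X. indep M X \<and> B \<subseteq> X \<longrightarrow> X = B)"

definition circuit :: "'a indep_system \<Rightarrow> 'a set \<Rightarrow> bool" where
  "circuit M C \<longleftrightarrow> C \<subseteq> ground M \<and> \<not> indep M C \<and> (\<forall>X. X \<subset> C \<longrightarrow> indep M X)"

text \<open>The dual matroid is the one whose bases are the complements of the bases of \<open>M\<close>;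
  its independent sets are the subsets of these complements.\<close>

definition dual :: "'a indep_system \<Rightarrow> 'a indep_system" where
  "dual M = \<lparr>ground = ground M, indep = (\<lambda>X. \<exists>B. basis M B \<and> X \<subseteq> ground M - B)\<rparr>"

definition cocircuit :: "'a indep_system \<Rightarrow> 'a set \<Rightarrow> bool" where
  "cocircuit M C \<longleftrightarrow> circuit (dual M) C"

definition n_circuit :: "nat \<Rightarrow> 'a indep_system \<Rightarrow> 'a set \<Rightarrow> bool" where
  "n_circuit t M C \<longleftrightarrow> circuit M C \<and> card C = t"

definition n_cocircuit :: "nat \<Rightarrow> 'a indep_system \<Rightarrow> 'a set \<Rightarrow> bool" where
  "n_cocircuit t M C \<longleftrightarrow> cocircuit M C \<and> card C = t"

text \<open>A cyclic ordering \<open>(e\<^sub>1, \<dots>, e\<^sub>n)\<close> is a list \<open>\<sigma>\<close> of length \<open>n\<close>. The term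
  \<open>cyc_nth \<sigma> i\<close> is \<open>e\<^sub>i\<close>, counted from 1 and with \<open>i\<close> read modulo \<open>n\<close>, whereas \<open>!\<close> counts
  from 0; adding \<open>n\<close> before subtracting 1 makes \<open>e\<^sub>0\<close> equal to \<open>e\<^sub>n\<close>.\<close>

definition cyc_nth :: "'a list \<Rightarrow> nat \<Rightarrow> 'a" where
  "cyc_nth \<sigma> i = \<sigma> ! ((i + length \<sigma> - 1) mod length \<sigma>)"

text \<open>\<open>consec \<sigma> i k\<close> is the set \<open>{e\<^sub>i, e\<^sub>i\<^sub>+\<^sub>1, \<dots>}\<close> of \<open>k\<close> consecutive
  elements starting at \<open>e\<^sub>i\<close>; it has exactly \<open>k\<close> elements if \<open>\<sigma>\<close> is distinct and
  \<open>k \<le> length \<sigma>\<close>.\<close>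

definition consec :: "'a list \<Rightarrow> nat \<Rightarrow> nat \<Rightarrow> 'a set" where
  "consec \<sigma> i k = cyc_nth \<sigma> ` {i..<i + k}"

definition cyclic_ordering_of :: "'a set \<Rightarrow> 'a list \<Rightarrow> bool" where
  "cyclic_ordering_of E \<sigma> \<longleftrightarrow> distinct \<sigma> \<and> set \<sigma> = E"

text \<open>The cyclic \<open>(t-1,t)\<close>-orderings of \<open>M\<close>; the notion is only used for \<open>t \<ge> 2\<close>.\<close>

definition cyclic_tm1_t_ordering :: "nat \<Rightarrow> 'a indep_system \<Rightarrow> 'a list \<Rightarrow> bool" where
  "cyclic_tm1_t_ordering t M \<sigma> \<longleftrightarrow>
     cyclic_ordering_of (ground M) \<sigma> \<and>
     (\<forall>i\<in>{1..length \<sigma>}.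
        (\<exists>C. n_circuit t M C \<and> consec \<sigma> i (t - 1) \<subseteq> C) \<and>
        (\<exists>D. n_cocircuit t M D \<and> consec \<sigma> i (t - 1) \<subseteq> D))"

end

theory Submission
  imports Defs
begin

text \<open>Matroid theory enters only through orthogonality: a circuit and a cocircuit never meet in
  exactly one element (\<open>circuit_cocircuit_orthogonal\<close>). The rest is an argument about two families
  of \<open>t\<close>-element sets on a cycle that are orthogonal to each other, each of which covers every
  \<^emph>\<open>window\<close> of \<open>t - 1\<close> consecutive positions (\<open>orthogonal_windows\<close>). Its hypotheses are invariant
  under swapping the two families and under reversing the cycle, so that every lemma yields up to
  four. A \<open>t\<close>-element circuit or cocircuit that contains a window is the window together with one
  further position, its \<^emph>\<open>extension\<close>.

  The heart of the proof is that the extension is always adjacent to its window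
  (\<open>extension_adjacent\<close>). Suppose that a circuit consists of a window and a position \<open>c\<close> separated
  from it by gaps of \<open>a\<close> and \<open>b\<close> positions, where \<open>1 \<le> a \<le> b\<close> and \<open>a + b = n - t\<close>. Cocircuits on
  windows around \<open>c\<close> that are disjoint from the given window must return to it, and comparing two
  neighbouring ones shows that the window moved by \<open>t - 2\<close> steps into the longer gap is
  completed by the same \<open>c\<close> to a cocircuit, provided that \<open>b \<ge> 2 * t - 4\<close>
  (\<open>shift_left_nonadjacent\<close>). If both gaps are at least \<open>2 * t - 4\<close>, the window can be moved in
  both directions, and a circuit on a window starting at \<open>c\<close> would have to be completed by a position
  in each of two disjoint windows, which is absurd (\<open>far_extension_False\<close>). Every move
  lengthens the shorter gap by \<open>t - 2\<close>, so at most two moves lead to this situation; the bound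
  \<open>n \<ge> 6 * t - 10\<close>, that is \<open>a + b \<ge> 5 * t - 10\<close>, leaves enough room in the other gap.

  Hence for every \<open>i\<close> one of the intervals of length \<open>t\<close> starting at \<open>i - 1\<close> and \<open>i\<close> is a circuit,
  and one is a cocircuit. A circuit interval and a cocircuit interval cannot start at distance
  \<open>t - 1\<close>, for they would meet in one element. Together these facts make circuit intervals
  alternate (\<open>F_I_alternates\<close>), which forces \<open>n\<close> to be even, and they place a cocircuit interval
  \<open>t\<close> steps after each circuit interval (\<open>F_I_imp_G\<close>); the parity of \<open>t\<close> then
  decides whether circuit and cocircuit intervals coincide or interlace.\<close>

section \<open>Orthogonality of circuits and cocircuits\<close>

context matroid
begin

lemma indep_finite: "indep M X \<Longrightarrow> finite X"
  using indep_subset_ground finite_ground finite_subset by blast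

lemma indep_extend:
  assumes "indep M X" "indep M Y" "card X \<le> card Y"
  shows "\<exists>Z. X \<subseteq> Z \<and> Z \<subseteq> X \<union> Y \<and> indep M Z \<and> card Z = card Y"
  using assms
proof (induction "card Y - card X" arbitrary: X)
  case 0
  then show ?case by (intro exI[of _ X]) auto
next
  case (Suc k)
  then have "card X < card Y" by linarith
  then obtain y where y: "y \<in> Y - X" "indep M (insert y X)"
    using augmentation[OF Suc.prems(1,2)] by blast
  have c: "card (insert y X) = Suc (card X)"
    using y indep_finite[OF Suc.prems(1)] by simp
  then have "\<exists>Z. insert y X \<subseteq> Z \<and> Z \<subseteq> insert y X \<union> Y \<and> indep M Z \<and> card Z = card Y"
    using Suc.hyps(1)[of "insert y X"] Suc.hyps(2) Suc.prems y by auto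
  then show ?case using y by blast
qed

lemma indep_card_le_basis:
  assumes "basis M B" "indep M X"
  shows "card X \<le> card B"
proof (rule ccontr)
  assume "\<not> card X \<le> card B"
  then obtain y where "y \<in> X - B" "indep M (insert y B)"
    using augmentation[of B X] assms by (auto simp: basis_def)
  then show False using assms(1) unfolding basis_def by blast
qed

lemma basisI_card:
  assumes "basis M B" "indep M X" "card X = card B"
  shows "basis M X"
  unfolding basis_def
proof (intro conjI allI impI)
  fix Y assume Y: "indep M Y \<and> X \<subseteq> Y"
  then have "card Y \<le> card X" using indep_card_le_basis[OF assms(1)] assms(3) by simp
  then show "Y = X" using Y card_seteq[of Y X] indep_finite by auto
qed (rule assms(2))

text \<open>Since \<open>D - {z}\<close> misses some basis \<open>B\<close> but \<open>D\<close> misses none, \<open>B\<close> meets \<open>D\<close> in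
  \<open>z\<close> alone. Extending \<open>C - {z}\<close> to a basis by elements of \<open>B\<close> yields a basis that can meet
  \<open>D\<close> only in \<open>z\<close>; so it contains \<open>z\<close>, and with it the whole circuit \<open>C\<close>.\<close>

lemma circuit_cocircuit_orthogonal:
  assumes C: "circuit M C" and D: "cocircuit M D"
  shows "C \<inter> D \<noteq> {z}"
proof
  assume z: "C \<inter> D = {z}"
  have D_sub: "D \<subseteq> ground M" and D_dep: "\<And>B. basis M B \<Longrightarrow> B \<inter> D \<noteq> {}"
    and D_min: "\<And>X. X \<subset> D \<Longrightarrow> \<exists>B. basis M B \<and> X \<subseteq> ground M - B"
    using D unfolding cocircuit_def circuit_def dual_def by auto
  have "D - {z} \<subset> D" using z by blast
  then obtain B where B: "basis M B" "D - {z} \<subseteq> ground M - B"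
    using D_min by blast
  have "C - {z} \<subset> C" using z by blast
  then have I: "indep M (C - {z})" using C unfolding circuit_def by blast
  have "indep M B" using B by (simp add: basis_def)
  then obtain Z where Z: "C - {z} \<subseteq> Z" "Z \<subseteq> (C - {z}) \<union> B" "indep M Z" "card Z = card B"
    using indep_extend[OF I _ indep_card_le_basis[OF B(1) I]] by blast
  have "Z \<inter> D \<noteq> {}" using D_dep basisI_card[OF B(1) Z(3,4)] by blast
  then have "z \<in> Z" using Z(2) B(2) z by blast
  then have "C \<subseteq> Z" using Z(1) by blast
  then show False using indep_subset[OF Z(3)] C by (simp add: circuit_def)
qed

end


section \<open>Orthogonal families covering the windows of a cycle\<close>

text \<open>Positions are arbitrary integers and \<open>e\<close> is the periodic enumeration of the cycle. With
  integers instead of residues, a configuration inside one period is a configuration of honest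
  intervals, and linear arithmetic decides all disjointness questions.\<close>

locale orthogonal_windows =
  fixes n t :: nat and e :: "int \<Rightarrow> 'a" and F G :: "'a set \<Rightarrow> bool"
  assumes t_ge: "3 \<le> t" and n_ge: "6 * t \<le> n + 10"
    and e_eq_iff: "e x = e y \<longleftrightarrow> x mod int n = y mod int n"
    and F_card: "F X \<Longrightarrow> card X = t" and G_card: "G X \<Longrightarrow> card X = t"
    and F_range: "F X \<Longrightarrow> X \<subseteq> range e" and G_range: "G X \<Longrightarrow> X \<subseteq> range e"
    and F_cover: "\<exists>X. F X \<and> e ` {i..i + int t - 2} \<subseteq> X"
    and G_cover: "\<exists>X. G X \<and> e ` {i..i + int t - 2} \<subseteq> X"
    and orthogonal: "F X \<Longrightarrow> G Y \<Longrightarrow> X \<inter> Y \<noteq> {a}"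
begin

abbreviation W :: "int \<Rightarrow> int set" where
  "W i \<equiv> {i..i + int t - 2}"

lemma swap: "orthogonal_windows n t e G F"
  using orthogonal by unfold_locales
    (auto simp: t_ge n_ge e_eq_iff F_card G_card F_cover G_cover dest: F_range G_range)

lemma image_reflect: "(\<lambda>x. e (- x)) ` S = e ` uminus ` S"
  by (simp add: image_image)

lemma reverse: "orthogonal_windows n t (\<lambda>x. e (- x)) F G"
proof
  have r: "range (\<lambda>x. e (- x)) = range e"
    by (metis image_reflect surj_uminus)
  fix x y i X Y a
  show "e (- x) = e (- y) \<longleftrightarrow> x mod int n = y mod int n"
    by (metis e_eq_iff mod_minus_cong minus_minus)
  show "F X \<Longrightarrow> X \<subseteq> range (\<lambda>x. e (- x))" "G X \<Longrightarrow> X \<subseteq> range (\<lambda>x. e (- x))"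
    using r F_range G_range by auto
  have "(\<lambda>x. e (- x)) ` W i = e ` W (2 - int t - i)"
    unfolding image_reflect by (simp add: algebra_simps)
  then show "\<exists>X. F X \<and> (\<lambda>x. e (- x)) ` W i \<subseteq> X" "\<exists>X. G X \<and> (\<lambda>x. e (- x)) ` W i \<subseteq> X"
    using F_cover G_cover by (metis (no_types, lifting))+
qed (use t_ge n_ge F_card G_card orthogonal in auto)

lemma n_pos: "int n > 0" using t_ge n_ge by linarith

lemma e_add: "e (x + int n) = e x"
  by (simp add: e_eq_iff)

lemma inj_on_period: "inj_on e {p..<p + int n}"
proof (rule inj_onI)
  fix x y assume "x \<in> {p..<p + int n}" "y \<in> {p..<p + int n}" "e x = e y"
  then have "int n dvd x - y" "\<bar>x - y\<bar> < int n"
    by (auto simp: e_eq_iff mod_eq_dvd_iff)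
  then show "x = y" using dvd_imp_le_int[of "x - y" "int n"] by fastforce
qed

lemma position_in_period: "\<exists>x\<in>{p..<p + int n}. e x = e y"
proof -
  define x where "x = p + (y - p) mod int n"
  have "e x = e y" unfolding e_eq_iff x_def by (simp add: mod_simps)
  moreover have "x \<in> {p..<p + int n}" unfolding x_def using n_pos by simp
  ultimately show ?thesis by blast
qed

lemma image_shift: "e ` {i + int n..j + int n} = e ` {i..j}"
proof -
  have "{i + int n..j + int n} = (\<lambda>x. x + int n) ` {i..j}" by simp
  then show ?thesis by (metis (no_types, lifting) e_add image_cong image_image)
qed

text \<open>Since \<open>e\<close> is injective on a period, orthogonality can be read off from integer intervals as
  long as all positions involved lie in one common period.\<close>

lemma orthogonal_positions:
  assumes "F (e ` S)" "G (e ` T)" "S \<subseteq> {p..<p + int n}" "T \<subseteq> {p..<p + int n}"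
  shows "S \<inter> T \<noteq> {z}"
proof
  assume "S \<inter> T = {z}"
  then have "e ` S \<inter> e ` T = {e z}"
    using inj_on_image_Int[OF inj_on_period assms(3,4)] by simp
  then show False using orthogonal assms(1,2) by blast
qed

lemma F_extension:
  assumes "F X" "e ` W i \<subseteq> X" "p \<le> i" "i + int t - 1 \<le> p + int n"
  shows "\<exists>x\<in>{p..<p + int n} - W i. X = e ` insert x (W i)"
proof -
  have sub: "W i \<subseteq> {p..<p + int n}" using assms(3,4) by auto
  have "card (e ` W i) = card (W i)"
    by (rule card_image) (rule inj_on_subset[OF inj_on_period sub])
  then have c: "card (e ` W i) = t - 1" using t_ge by simp
  have "card (X - e ` W i) = 1"
    using card_Diff_subset[OF _ assms(2)] c F_card[OF assms(1)] t_ge by simp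
  then obtain y where y: "X - e ` W i = {y}" by (auto simp: card_1_singleton_iff)
  then have "y \<in> range e" using F_range[OF assms(1)] by blast
  then obtain x where x: "x \<in> {p..<p + int n}" "e x = y" using position_in_period by blast
  have "X = e ` insert x (W i)" using y x assms(2) by auto
  moreover have "x \<notin> W i" using y x by blast
  ultimately show ?thesis using x by blast
qed

lemma F_window:
  assumes "p \<le> i" "i + int t - 1 \<le> p + int n"
  obtains x where "x \<in> {p..<p + int n}" "x \<notin> W i" "F (e ` insert x (W i))"
proof -
  obtain X where "F X" "e ` W i \<subseteq> X" using F_cover by blast
  then show ?thesis using F_extension[OF _ _ assms] that by blast
qed

lemma G_window:
  assumes "p \<le> i" "i + int t - 1 \<le> p + int n"
  obtains x where "x \<in> {p..<p + int n}" "x \<notin> W i" "G (e ` insert x (W i))"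
  using orthogonal_windows.F_window[OF swap assms] by blast

text \<open>If the windows are disjoint, the two sets can meet only in the extensions, so each extension that
  lies in the opposite window needs the other one to do the same.\<close>

lemma disjoint_windows:
  assumes F: "F (e ` insert x (W i))" and G: "G (e ` insert y (W j))"
    and sub: "W i \<subseteq> {p..<p + int n}" "W j \<subseteq> {p..<p + int n}"
    and x: "x \<in> {p..<p + int n}" and y: "y \<in> {p..<p + int n}"
    and disj: "W i \<inter> W j = {}" and xy: "x \<notin> W i" "y \<notin> W j"
  shows "x \<in> W j \<longleftrightarrow> y \<in> W i" and "x \<notin> W j \<Longrightarrow> x \<noteq> y"
proof -
  have neq: "insert x (W i) \<inter> insert y (W j) \<noteq> {z}" for z
    using orthogonal_positions[OF F G, of p] sub x y by simp
  show "x \<in> W j \<longleftrightarrow> y \<in> W i"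
    using neq[of x] neq[of y] disj xy by blast
  show "x \<notin> W j \<Longrightarrow> x \<noteq> y"
    using neq[of x] disj xy by blast
qed

lemma touching_windows:
  assumes F: "F (e ` insert x (W i))" and G: "G (e ` insert y (W j))"
    and sub: "W i \<subseteq> {p..<p + int n}" "W j \<subseteq> {p..<p + int n}"
    and x: "x \<in> {p..<p + int n}" and y: "y \<in> {p..<p + int n}"
    and touch: "W i \<inter> W j = {z}"
  shows "x \<in> W j \<or> y \<in> W i \<or> x = y"
  using orthogonal_positions[OF F G, of p z] sub x y touch by blast


section \<open>Extensions are adjacent to their windows\<close>

text \<open>In what follows the extension \<open>c\<close> lies to the left of the window \<open>W i\<close>. Then the gap from \<open>c\<close>
  rightwards to the window has \<open>i - 1 - c\<close> positions, and the gap from the window rightwards to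
  \<open>c + n\<close> has \<open>c + n - i - t + 1\<close>. The hypotheses called \<open>left\<close> say that the former is at least
  \<open>2 * t - 4\<close>, those called \<open>right\<close> bound the latter from below by \<open>1\<close>, \<open>2\<close> or \<open>2 * t - 4\<close>.

  The windows \<open>W c\<close> and \<open>W (c - 1)\<close> contain \<open>c\<close> and are disjoint from \<open>W i\<close>, so their extensions
  \<open>y\<close> and \<open>y'\<close> lie in \<open>W i\<close>. The window starting at the last position of \<open>W c\<close> lies in the
  long gap, touches \<open>W c\<close>, and is disjoint from \<open>W (c - 1)\<close>. Orthogonality to the first set leaves
  for its extension only \<open>W c\<close> or \<open>y\<close>; orthogonality to the second one excludes \<open>W (c - 1)\<close>
  and \<open>y'\<close>. Only \<open>y\<close> remains, and it differs from \<open>y'\<close>.\<close>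

lemma extension_exchange:
  assumes C: "F (e ` insert c (W i))" and left: "c \<le> i - 2 * int t + 3"
    and right: "i + int t \<le> c + int n"
  obtains y y' where "y \<in> W i" "y' \<in> W i" "y \<noteq> y'"
    "G (e ` insert y (W c))" "G (e ` insert y' (W (c - 1)))"
    "F (e ` insert y (W (c + int t - 2)))"
proof -
  define p where "p = c - 1"
  define k where "k = c + int t - 2"
  note defs = p_def k_def
  note t3 = t_ge
  have ci: "c \<in> {p..<p + int n}" "c \<notin> W i"
    using left right t3 by (auto simp: defs)
  obtain y where y: "y \<in> {p..<p + int n}" "y \<notin> W c" "G (e ` insert y (W c))"
    using G_window[of p c] left right t3 by (auto simp: defs)
  obtain y' where y': "y' \<in> {p..<p + int n}" "y' \<notin> W (c - 1)" "G (e ` insert y' (W (c - 1)))"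
    using G_window[of p "c - 1"] left right t3 by (auto simp: defs)
  obtain x where x: "x \<in> {p..<p + int n}" "x \<notin> W k" "F (e ` insert x (W k))"
    using F_window[of p k] left right t3 by (auto simp: defs)
  have sub: "W i \<subseteq> {p..<p + int n}" "W c \<subseteq> {p..<p + int n}" "W (c - 1) \<subseteq> {p..<p + int n}"
    "W k \<subseteq> {p..<p + int n}"
    using left right t3 by (auto simp: defs)
  have yi: "y \<in> W i"
    using disjoint_windows(1)[OF C y(3) sub(1,2) ci(1) y(1) _ ci(2) y(2)] left right t3 by auto
  have yi': "y' \<in> W i"
    using disjoint_windows(1)[OF C y'(3) sub(1,3) ci(1) y'(1) _ ci(2) y'(2)] left right t3 by auto
  have "W k \<inter> W c = {k}" "W k \<inter> W (c - 1) = {}"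
    using left right t3 by (auto simp: defs)
  note xy = touching_windows[OF x(3) y(3) sub(4,2) x(1) y(1) this(1)]
    disjoint_windows[OF x(3) y'(3) sub(4,3) x(1) y'(1) this(2) x(2) y'(2)]
  have "y \<notin> W k" "y' \<notin> W k" using yi yi' left by (auto simp: defs)
  moreover have "W c \<subseteq> W (c - 1) \<union> W k" using t3 by (auto simp: defs)
  ultimately have "x = y" "y \<noteq> y'" using xy x(2) by blast+
  then show ?thesis using that yi yi' y(3) y'(3) x(3) by (simp add: k_def)
qed

text \<open>The moved window \<open>W (i - t + 2)\<close> has just its last position \<open>i\<close> in common with \<open>W i\<close>, so its
  extension \<open>d\<close> is \<open>c\<close> or lies in \<open>W i - {i}\<close>. The latter set is part of \<open>W (i + 1)\<close>, whose own extension
  \<open>x\<close> lies in \<open>W j\<close> by orthogonality to the set with extension \<open>y\<close>. As \<open>W j\<close> misses the moved window,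
  \<open>d\<close> cannot lie in \<open>W (i + 1)\<close>. The bound \<open>i + t \<le> j + n\<close> keeps \<open>W (i + 1)\<close> disjoint
  from \<open>W j\<close> around the cycle.\<close>

lemma shift_left_by:
  assumes C: "F (e ` insert c (W i))" and left: "c \<le> i - 2 * int t + 3"
    and D: "G (e ` insert y (W j))" and y: "y \<in> W i" "y \<noteq> i"
    and j: "j \<le> c" "c \<in> W j" "i + int t \<le> j + int n"
  shows "G (e ` insert c (W (i - int t + 2)))"
proof -
  define l where "l = i - int t + 2"
  note t3 = t_ge
  obtain x where x: "x \<in> {j..<j + int n}" "x \<notin> W (i + 1)" "F (e ` insert x (W (i + 1)))"
    using F_window[of j "i + 1"] left j t3 by auto
  obtain d where d: "d \<in> {j..<j + int n}" "d \<notin> W l" "G (e ` insert d (W l))"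
    using G_window[of j l] left j t3 by (auto simp: l_def)
  have sub: "W i \<subseteq> {j..<j + int n}" "W j \<subseteq> {j..<j + int n}"
    "W (i + 1) \<subseteq> {j..<j + int n}" "W l \<subseteq> {j..<j + int n}" "c \<in> {j..<j + int n}"
    "y \<in> {j..<j + int n}" "y \<notin> W j"
    using left j y t3 by (auto simp: l_def)
  have "y \<in> W (i + 1)" using y by auto
  then have "x \<in> W j"
    using disjoint_windows(1)[OF x(3) D sub(3,2) x(1) sub(6) _ x(2) sub(7)] left j by auto
  then have "x \<notin> W l" using left j by (auto simp: l_def)
  moreover have "W (i + 1) \<inter> W l = {}" by (auto simp: l_def)
  ultimately have "d \<notin> W (i + 1)"
    using disjoint_windows(1)[OF x(3) d(3) sub(3,4) x(1) d(1) _ x(2) d(2)] by blast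
  then have "d \<notin> W i" using d(2) t3 by (auto simp: l_def)
  moreover have "c \<notin> W l" using left t3 by (auto simp: l_def)
  moreover have "W i \<inter> W l = {i}" using t3 by (auto simp: l_def)
  ultimately have "d = c"
    using touching_windows[OF C d(3) sub(1,4) sub(5) d(1)] by blast
  then show ?thesis using d(3) by (simp add: l_def)
qed

text \<open>With at least two positions in the right gap, both \<open>W c\<close> and \<open>W (c - 1)\<close> are disjoint from
  \<open>W (i + 1)\<close>, so whichever of \<open>y\<close> and \<open>y'\<close> differs from \<open>i\<close> can be used.\<close>

lemma shift_left:
  assumes C: "F (e ` insert c (W i))" and left: "c \<le> i - 2 * int t + 3"
    and right: "i + int t + 1 \<le> c + int n"
  shows "G (e ` insert c (W (i - int t + 2)))"
proof -
  have "i + int t \<le> c + int n" using right by simp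
  then obtain y y' where y: "y \<in> W i" "y' \<in> W i" "y \<noteq> y'"
    "G (e ` insert y (W c))" "G (e ` insert y' (W (c - 1)))"
    using extension_exchange[OF C left] by metis
  show ?thesis
  proof (cases "y = i")
    case False
    then show ?thesis using shift_left_by[OF C left y(4,1)] right t_ge by simp
  next
    case True
    then show ?thesis using shift_left_by[OF C left y(5,2)] y(3) right t_ge by simp
  qed
qed

text \<open>The mirror image of \<open>shift_left\<close>, with \<open>c\<close> to the right of the window: \<open>right\<close> is now the
  long gap, \<open>c - i - t + 1\<close>, and \<open>left\<close> the one from \<open>c - n\<close> to the window.\<close>

lemma shift_right:
  assumes C: "F (e ` insert c (W i))" and right: "i + 3 * int t - 5 \<le> c"
    and left: "c \<le> i + int n - 3"
  shows "G (e ` insert c (W (i + int t - 2)))"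
proof -
  interpret rev: orthogonal_windows n t "\<lambda>x. e (- x)" F G by (rule reverse)
  have "F ((\<lambda>x. e (- x)) ` insert (- c) (W (2 - int t - i)))"
    using C unfolding image_reflect by (simp add: algebra_simps)
  from rev.shift_left[OF this] left right show ?thesis
    unfolding image_reflect by (simp add: algebra_simps)
qed

text \<open>Both neighbours \<open>W (i - t + 2)\<close> and \<open>W (i + t - 2)\<close> of \<open>W i\<close> are completed by \<open>c\<close>, and \<open>W c\<close> is
  disjoint from both. So the extension of \<open>W c\<close> lies in both of them, although they are
  disjoint.\<close>

lemma far_extension_False:
  assumes C: "F (e ` insert c (W i))" and left: "c \<le> i - 2 * int t + 3"
    and right: "i + 3 * int t - 5 \<le> c + int n"
  shows False
proof -
  have 1: "G (e ` insert c (W (i - int t + 2)))"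
    using shift_left[OF C left] right t_ge by simp
  have "F (e ` insert (c + int n) (W i))" using C by (simp add: e_add)
  then have 2: "G (e ` insert c (W (i + int t - 2)))"
    using shift_right[of "c + int n" i] left right t_ge by (simp add: e_add)
  obtain x where x: "x \<in> {c..<c + int n}" "x \<notin> W c" "F (e ` insert x (W c))"
    using F_window[of c c] left right t_ge by auto
  have sub: "W c \<subseteq> {c..<c + int n}" "W (i - int t + 2) \<subseteq> {c..<c + int n}"
    "W (i + int t - 2) \<subseteq> {c..<c + int n}" "c \<in> {c..<c + int n}" "c \<in> W c"
    using left right t_ge by auto
  have "x \<in> W (i - int t + 2)"
    using disjoint_windows(1)[OF x(3) 1 sub(1,2) x(1) sub(4) _ x(2)] left t_ge sub(5) by auto
  moreover have "x \<in> W (i + int t - 2)"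
    using disjoint_windows(1)[OF x(3) 2 sub(1,3) x(1) sub(4) _ x(2)] left t_ge sub(5) by auto
  ultimately show False using t_ge by auto
qed

text \<open>If the right gap is a single position, then \<open>W (c - 1)\<close> meets \<open>W (i + 1)\<close>, and only \<open>W c\<close> can
  be used. It fails just if its extension is \<open>i\<close>; but then the window \<open>W (c + t - 2)\<close> is also completed
  by \<open>i\<close>, which is far from it on both sides.\<close>

lemma shift_left_nonadjacent:
  assumes C: "F (e ` insert c (W i))" and left: "c \<le> i - 2 * int t + 3"
    and right: "i + int t \<le> c + int n"
  shows "G (e ` insert c (W (i - int t + 2)))"
proof (cases "i + int t = c + int n")
  case False
  then show ?thesis using shift_left[OF C left] right by simp
next
  case True
  obtain y where y: "y \<in> W i" "G (e ` insert y (W c))" "F (e ` insert y (W (c + int t - 2)))"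
    using extension_exchange[OF C left right] by metis
  have "y \<noteq> i"
  proof
    assume "y = i"
    then have "F (e ` insert (i - int n) (W (c + int t - 2)))"
      using y(3) e_add[of "i - int n"] by simp
    moreover have "6 * int t \<le> int n + 10" using n_ge by linarith
    ultimately show False
      using far_extension_False[of "i - int n" "c + int t - 2"] True t_ge by simp
  qed
  then show ?thesis using shift_left_by[OF C left y(2,1)] right t_ge by simp
qed

text \<open>The shorter gap is the one on the right. Each move to the left turns a set of one
  family into a set of the other and adds \<open>t - 2\<close> to this gap; as it starts with at least one
  position, two moves bring it to at least \<open>2 * t - 4\<close>.\<close>

lemma nonadjacent_False:
  assumes C: "F (e ` insert c (W i))" and right: "i + int t \<le> c + int n"
    and longer: "c + int n - i - int t + 1 \<le> i - 1 - c"
  shows False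
proof -
  interpret swapped: orthogonal_windows n t e G F by (rule swap)
  have n: "6 * int t \<le> int n + 10" using n_ge by linarith
  note t3 = t_ge
  define l where "l = i - int t + 2"
  show False
  proof (cases "i + 3 * int t - 5 \<le> c + int n")
    case True
    then show False using far_extension_False[OF C] n longer by simp
  next
    case False
    then have D: "G (e ` insert c (W l))"
      using shift_left_nonadjacent[OF C _ right] n t3 by (simp add: l_def)
    show False
    proof (cases "l + 3 * int t - 5 \<le> c + int n")
      case True
      then show False using swapped.far_extension_False[OF D] n t3 False by (simp add: l_def)
    next
      case l: False
      have C': "F (e ` insert c (W (l - int t + 2)))"
        using swapped.shift_left[OF D] n t3 l right by (simp add: l_def)
      show False using far_extension_False[OF C'] n t3 l right by (simp add: l_def)
    qed
  qed
qed

lemma extension_adjacent: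
  assumes "F X" "e ` W i \<subseteq> X"
  shows "X = e ` {i..i + int t - 1} \<or> X = e ` {i - 1..i + int t - 2}"
proof -
  interpret rev: orthogonal_windows n t "\<lambda>x. e (- x)" F G by (rule reverse)
  have n: "6 * int t \<le> int n + 10" using n_ge by linarith
  define p where "p = i + int t - 1 - int n"
  have "p \<le> i" "i + int t - 1 \<le> p + int n" using n t_ge by (auto simp: p_def)
  \<comment> \<open>The period that ends with \<open>W i\<close>, so that the extension lies to the left of the window and the
    position following the window appears as \<open>p\<close>.\<close>
  then obtain c where c: "c \<in> {p..<p + int n}" "c \<notin> W i" "X = e ` insert c (W i)"
    using F_extension[OF assms] by blast
  then have c_lt: "c < i" by (auto simp: p_def)
  have F: "F (e ` insert c (W i))" using assms(1) c(3) by simp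
  consider "c = i - 1" | "c = p" | "p < c" "c < i - 1" using c c_lt by force
  then show ?thesis
  proof cases
    case 1
    then have "insert c (W i) = {i - 1..i + int t - 2}" using t_ge by auto
    then show ?thesis using c(3) by simp
  next
    case 2
    have "insert (c + int n) (W i) = {i..i + int t - 1}" using 2 t_ge by (auto simp: p_def)
    moreover have "X = e ` insert (c + int n) (W i)" using c(3) by (simp add: e_add)
    ultimately show ?thesis by simp
  next
    case 3
    have "F (e ` insert (c + int n) (W i))" using F by (simp add: e_add)
    then have R: "F ((\<lambda>x. e (- x)) ` insert (- (c + int n)) (W (2 - int t - i)))"
      unfolding image_reflect by (simp add: algebra_simps)
    have "c + int n - i - int t + 1 \<le> i - 1 - c \<or> i - 1 - c \<le> c + int n - i - int t + 1"
      by linarith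
    then have False
      using nonadjacent_False[OF F] rev.nonadjacent_False[OF R] 3 unfolding p_def by linarith
    then show ?thesis ..
  qed
qed


section \<open>The alternating pattern\<close>

abbreviation I :: "int \<Rightarrow> 'a set" where
  "I i \<equiv> e ` {i..i + int t - 1}"

lemma F_I_or: "F (I i) \<or> F (I (i - 1))"
proof -
  obtain X where "F X" "e ` W i \<subseteq> X" using F_cover by blast
  then show ?thesis using extension_adjacent by fastforce
qed

lemma G_I_or: "G (I i) \<or> G (I (i - 1))"
  by (rule orthogonal_windows.F_I_or[OF swap])

lemma I_shift: "I (i + int n) = I i"
  using image_shift[of i "i + int t - 1"] by (simp add: algebra_simps)

lemma F_I_not_G_right:
  assumes "F (I i)" shows "\<not> G (I (i + int t - 1))"
proof
  assume G: "G (I (i + int t - 1))"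
  have n: "6 * int t \<le> int n + 10" using n_ge by linarith
  have "{i..i + int t - 1} \<inter> {i + int t - 1..i + int t - 1 + int t - 1} = {i + int t - 1}"
    using t_ge by auto
  moreover have "{i..i + int t - 1} \<subseteq> {i..<i + int n}"
    "{i + int t - 1..i + int t - 1 + int t - 1} \<subseteq> {i..<i + int n}"
    using n t_ge by auto
  ultimately show False using orthogonal_positions[OF assms G] by blast
qed

lemma F_I_imp_G:
  assumes "F (I i)" shows "G (I (i + int t))"
  using F_I_not_G_right[OF assms] G_I_or[of "i + int t"] by blast

text \<open>Two consecutive intervals in \<open>F\<close> are impossible: an interval in \<open>F\<close> starting at \<open>i + 1\<close> keeps
  the one starting at \<open>i + t\<close> out of \<open>G\<close>, so the one starting at \<open>i + t - 1\<close> is in \<open>G\<close>, and it meets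
  the interval starting at \<open>i\<close> in one element.\<close>

lemma F_I_alternates: "F (I (i + 1)) \<longleftrightarrow> \<not> F (I i)"
proof
  assume "F (I (i + 1))"
  then have "G (I (i + int t - 1))"
    using F_I_not_G_right[of "i + 1"] G_I_or[of "i + int t"] by (simp add: algebra_simps)
  then show "\<not> F (I i)" using F_I_not_G_right by blast
qed (use F_I_or[of "i + 1"] in simp)

lemma F_I_parity: "F (I (i + int k)) \<longleftrightarrow> (F (I i) \<longleftrightarrow> even k)"
proof (induction k)
  case (Suc k)
  then show ?case using F_I_alternates[of "i + int k"] by (simp add: algebra_simps)
qed simp

text \<open>Going once around the cycle returns to the same interval.\<close>

lemma even_n: "even n"
  using F_I_parity[of 0 n] unfolding I_shift by argo

lemma F_I_iff_G_I: "F (I i) \<longleftrightarrow> G (I (i + int t))"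
proof
  show "G (I (i + int t)) \<Longrightarrow> F (I i)"
    using F_I_imp_G[of "i + 1"] F_I_alternates[of i]
      orthogonal_windows.F_I_alternates[OF swap, of "i + int t"] by (auto simp: algebra_simps)
qed (rule F_I_imp_G)

lemma F_I_iff_G_I_parity: "F (I i) \<longleftrightarrow> (G (I i) \<longleftrightarrow> even t)"
  using F_I_iff_G_I orthogonal_windows.F_I_parity[OF swap, of i t] by blast

lemma extension_unique: "\<exists>!X. F X \<and> e ` W i \<subseteq> X"
proof -
  have "F (I i) \<longleftrightarrow> \<not> F (I (i - 1))" using F_I_alternates[of "i - 1"] by simp
  moreover have "e ` W i \<subseteq> I i" "e ` W i \<subseteq> I (i - 1)" by auto
  moreover have "X = I i \<or> X = I (i - 1)" if "F X" "e ` W i \<subseteq> X" for X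
    using extension_adjacent[OF that] by (simp add: algebra_simps)
  ultimately show ?thesis by metis
qed

end


section \<open>Cyclic orderings of a matroid\<close>

text \<open>This is \<open>cyc_nth\<close> with integer subscripts, so that positions before the start of the list
  make sense as well.\<close>

definition periodic_nth :: "'a list \<Rightarrow> int \<Rightarrow> 'a" where
  "periodic_nth \<sigma> x = \<sigma> ! nat ((x - 1) mod int (length \<sigma>))"

lemma cyc_nth_eq_periodic_nth:
  assumes "\<sigma> \<noteq> []"
  shows "cyc_nth \<sigma> i = periodic_nth \<sigma> (int i)"
proof -
  have "int ((i + length \<sigma> - 1) mod length \<sigma>) = (int i - 1 + int (length \<sigma>)) mod int (length \<sigma>)"
    using assms by (simp add: zmod_int of_nat_diff Suc_leI algebra_simps)
  then have "nat ((int i - 1) mod int (length \<sigma>)) = (i + length \<sigma> - 1) mod length \<sigma>"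
    by simp
  then show ?thesis by (simp add: cyc_nth_def periodic_nth_def)
qed

lemma consec_eq_image_periodic_nth:
  assumes "\<sigma> \<noteq> []"
  shows "consec \<sigma> i k = periodic_nth \<sigma> ` {int i..int i + int k - 1}"
proof -
  have "{int i..int i + int k - 1} = int ` {i..<i + k}"
    by (auto simp: image_int_atLeastLessThan)
  then show ?thesis
    by (simp add: consec_def cyc_nth_eq_periodic_nth[OF assms] image_image)
qed

lemma periodic_nth_eq_iff:
  assumes "distinct \<sigma>" "\<sigma> \<noteq> []"
  shows "periodic_nth \<sigma> x = periodic_nth \<sigma> y \<longleftrightarrow> x mod int (length \<sigma>) = y mod int (length \<sigma>)"
proof -
  have "periodic_nth \<sigma> x = periodic_nth \<sigma> y \<longleftrightarrow>
      (x - 1) mod int (length \<sigma>) = (y - 1) mod int (length \<sigma>)"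
    using assms by (simp add: periodic_nth_def nth_eq_iff_index_eq nat_less_iff eq_nat_nat_iff)
  then show ?thesis by (simp add: mod_eq_dvd_iff)
qed

lemma range_periodic_nth:
  assumes "\<sigma> \<noteq> []"
  shows "range (periodic_nth \<sigma>) = set \<sigma>"
proof
  show "range (periodic_nth \<sigma>) \<subseteq> set \<sigma>"
    using assms by (auto simp: periodic_nth_def nat_less_iff)
  show "set \<sigma> \<subseteq> range (periodic_nth \<sigma>)"
  proof
    fix a assume "a \<in> set \<sigma>"
    then obtain k where "k < length \<sigma>" "a = \<sigma> ! k" by (auto simp: in_set_conv_nth)
    then have "a = periodic_nth \<sigma> (int k + 1)" by (simp add: periodic_nth_def)
    then show "a \<in> range (periodic_nth \<sigma>)" by simp
  qed
qed

lemma orthogonal_windows_matroid: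
  assumes t: "t \<ge> 3" and M: "matroid M" and \<sigma>: "cyclic_tm1_t_ordering t M \<sigma>"
    and n: "length \<sigma> \<ge> 6 * t - 10"
  shows "orthogonal_windows (length \<sigma>) t (periodic_nth \<sigma>) (n_circuit t M) (n_cocircuit t M)"
proof -
  have "\<sigma> \<noteq> []" using t n by auto
  have d: "distinct \<sigma>" "set \<sigma> = ground M"
    using \<sigma> by (auto simp: cyclic_tm1_t_ordering_def cyclic_ordering_of_def)
  have window: "\<exists>j\<in>{1..length \<sigma>}. periodic_nth \<sigma> ` {i..i + int t - 2} = consec \<sigma> j (t - 1)" for i
  proof -
    define m where "m = int (length \<sigma>)"
    define j where "j = nat ((i - 1) mod m) + 1"
    have m: "m > 0" using \<open>\<sigma> \<noteq> []\<close> by (simp add: m_def)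
    then have j: "int j = (i - 1) mod m + 1" by (simp add: j_def)
    have "0 \<le> (i - 1) mod m" "(i - 1) mod m < m" using m by simp_all
    then have "1 \<le> int j" "int j \<le> m" using j by linarith+
    then have "j \<in> {1..length \<sigma>}" by (simp add: m_def)
    define s where "s = int j - i"
    have "i - int j = (i - 1) - (i - 1) mod m" using j by simp
    then have "m dvd i - int j" by (simp only: dvd_minus_mod)
    then have "m dvd s" by (simp add: s_def dvd_diff_commute)
    then have periodic: "periodic_nth \<sigma> (x + s) = periodic_nth \<sigma> x" for x
      by (simp add: periodic_nth_eq_iff[OF d(1) \<open>\<sigma> \<noteq> []\<close>] m_def mod_eq_dvd_iff)
    have "{int j..int j + int (t - 1) - 1} = (\<lambda>x. x + s) ` {i..i + int t - 2}"
      unfolding image_add_atLeastAtMost' using t by (simp add: s_def algebra_simps)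
    moreover have "periodic_nth \<sigma> ` (\<lambda>x. x + s) ` {i..i + int t - 2} =
        periodic_nth \<sigma> ` {i..i + int t - 2}"
      unfolding image_image periodic ..
    ultimately have "consec \<sigma> j (t - 1) = periodic_nth \<sigma> ` {i..i + int t - 2}"
      using consec_eq_image_periodic_nth[OF \<open>\<sigma> \<noteq> []\<close>] by metis
    with \<open>j \<in> {1..length \<sigma>}\<close> show ?thesis by metis
  qed
  show ?thesis
  proof
    show "3 \<le> t" "6 * t \<le> length \<sigma> + 10" using t n by auto
    fix i x y X Y a
    show "\<exists>X. n_circuit t M X \<and> periodic_nth \<sigma> ` {i..i + int t - 2} \<subseteq> X"
      "\<exists>X. n_cocircuit t M X \<and> periodic_nth \<sigma> ` {i..i + int t - 2} \<subseteq> X"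
      using window[of i] \<sigma> by (auto simp: cyclic_tm1_t_ordering_def)
    show "n_circuit t M X \<Longrightarrow> n_cocircuit t M Y \<Longrightarrow> X \<inter> Y \<noteq> {a}"
      using matroid.circuit_cocircuit_orthogonal[OF M] by (auto simp: n_circuit_def n_cocircuit_def)
    show "periodic_nth \<sigma> x = periodic_nth \<sigma> y \<longleftrightarrow> x mod int (length \<sigma>) = y mod int (length \<sigma>)"
      by (rule periodic_nth_eq_iff[OF d(1) \<open>\<sigma> \<noteq> []\<close>])
    show "n_circuit t M X \<Longrightarrow> X \<subseteq> range (periodic_nth \<sigma>)"
      "n_cocircuit t M X \<Longrightarrow> X \<subseteq> range (periodic_nth \<sigma>)"
      unfolding range_periodic_nth[OF \<open>\<sigma> \<noteq> []\<close>] d(2)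
      by (auto simp: n_circuit_def n_cocircuit_def cocircuit_def circuit_def dual_def)
  qed (simp_all add: n_circuit_def n_cocircuit_def)
qed

theorem theorem1p1:
  fixes t n :: nat and M :: "'a indep_system" and \<sigma> :: "'a list"
  assumes "t \<ge> 3"
    and "matroid M"
    and "cyclic_tm1_t_ordering t M \<sigma>"
    and "n = length \<sigma>"
    and "n \<ge> 6 * t - 10"
  shows "even n \<and>
    (\<forall>i\<in>{1..n}.
       (\<exists>!C. n_circuit t M C \<and> consec \<sigma> i (t - 1) \<subseteq> C) \<and>
       (\<exists>!D. n_cocircuit t M D \<and> consec \<sigma> i (t - 1) \<subseteq> D)) \<and>
    (odd t \<longrightarrow>
       (\<forall>i\<in>{1..n}.
          (n_circuit t M (consec \<sigma> i t) \<or> n_cocircuit t M (consec \<sigma> i t)) \<and>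
          \<not> (n_circuit t M (consec \<sigma> i t) \<and> n_cocircuit t M (consec \<sigma> i t))) \<and>
       (\<forall>i\<in>{1..n}.
          n_circuit t M (consec \<sigma> i t) \<longleftrightarrow> n_cocircuit t M (consec \<sigma> (i + 1) t)) \<and>
       (\<forall>i\<in>{1..n}. \<forall>j\<in>{1..n}. j mod 2 = i mod 2 \<longrightarrow>
          n_circuit t M (consec \<sigma> i t) \<longrightarrow> n_circuit t M (consec \<sigma> j t))) \<and>
    (even t \<longrightarrow>
       (\<forall>i\<in>{1..n}.
          (n_circuit t M (consec \<sigma> i t) \<or> n_circuit t M (consec \<sigma> (i + 1) t)) \<and>
          \<not> (n_circuit t M (consec \<sigma> i t) \<and> n_circuit t M (consec \<sigma> (i + 1) t))) \<and>
       (\<forall>i\<in>{1..n}.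
          n_circuit t M (consec \<sigma> i t) \<longleftrightarrow> n_cocircuit t M (consec \<sigma> i t)) \<and>
       (\<forall>i\<in>{1..n}. \<forall>j\<in>{1..n}. j mod 2 = i mod 2 \<longrightarrow>
          n_circuit t M (consec \<sigma> i t) \<longrightarrow> n_circuit t M (consec \<sigma> j t)))"
proof -
  interpret orthogonal_windows n t "periodic_nth \<sigma>" "n_circuit t M" "n_cocircuit t M"
    using orthogonal_windows_matroid assms by blast
  interpret dual: orthogonal_windows n t "periodic_nth \<sigma>" "n_cocircuit t M" "n_circuit t M"
    by (rule swap)
  have ne: "\<sigma> \<noteq> []" using assms(1,4,5) by auto
  have full: "consec \<sigma> i t = I (int i)" for i
    by (rule consec_eq_image_periodic_nth[OF ne])
  have win: "consec \<sigma> i (t - 1) = periodic_nth \<sigma> ` W (int i)" for i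
    using assms(1) by (simp add: consec_eq_image_periodic_nth[OF ne] of_nat_diff)
  have step: "n_circuit t M (consec \<sigma> (i + 1) t) \<longleftrightarrow> \<not> n_circuit t M (consec \<sigma> i t)"
    "n_cocircuit t M (consec \<sigma> (i + 1) t) \<longleftrightarrow> \<not> n_cocircuit t M (consec \<sigma> i t)" for i
    using F_I_alternates[of "int i"] dual.F_I_alternates[of "int i"] unfolding full
    by (simp_all add: add.commute)
  have circ_cocirc:
    "n_circuit t M (consec \<sigma> i t) \<longleftrightarrow> (n_cocircuit t M (consec \<sigma> i t) \<longleftrightarrow> even t)" for i
    unfolding full by (rule F_I_iff_G_I_parity)
  have same_le: "n_circuit t M (consec \<sigma> i t) \<longleftrightarrow> n_circuit t M (consec \<sigma> j t)"
    if "i \<le> j" "j mod 2 = i mod 2" for i j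
  proof -
    have "even (j - i)" using that by (simp add: mod_eq_dvd_iff_nat)
    then show ?thesis
      using F_I_parity[of "int i" "j - i"] that(1) unfolding full by (simp add: of_nat_diff)
  qed
  have same: "n_circuit t M (consec \<sigma> j t)"
    if "j mod 2 = i mod 2" "n_circuit t M (consec \<sigma> i t)" for i j
    using same_le[of i j] same_le[of j i] that by (metis nat_le_linear)
  have unique: "\<exists>!C. n_circuit t M C \<and> consec \<sigma> i (t - 1) \<subseteq> C"
    "\<exists>!D. n_cocircuit t M D \<and> consec \<sigma> i (t - 1) \<subseteq> D" for i
    unfolding win by (rule extension_unique dual.extension_unique)+
  show ?thesis
  proof (intro conjI impI)
    show "even n" by (rule even_n)
    show "\<forall>i\<in>{1..n}. (\<exists>!C. n_circuit t M C \<and> consec \<sigma> i (t - 1) \<subseteq> C) \<and>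
        (\<exists>!D. n_cocircuit t M D \<and> consec \<sigma> i (t - 1) \<subseteq> D)"
      by (intro ballI conjI unique)
  qed (intro ballI impI conjI; metis step circ_cocirc same)+
qed

end
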